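(* Let $R$ be an integral domain and let $L_1,\dots,L_n\in\mathrm{Mat}_d(R)$ be upper triangular matrices, $L_k$ having diagonal entries $r_k^1,\dots,r_k^d$. Suppose that for every $i\in\{1,\dots,d\}$ the separating condition holds: for every $j\in\{1,\dots,d\}\setminus\{i\}$ there exists $k\in\{1,\dots,n\}$ with $r_k^i-r_k^j\in R^\times$. Then $\{L_1,\dots,L_n\}$ gives rise to a complete set of orthogonal idempotents: the elements $e_1,\dots,e_d$ of $\mathrm{Mat}_d(R)$ produced from $L_1,\dots,L_n$ by the construction described in the context are pairwise orthogonal idempotents and $e_1+\dots+e_d=\mathbf 1$.
   Context: The matrices $L_k$ represent the action, with respect to an ordered basis, of elements of an $R$-algebra on an $R$-free module of rank $d$; they are not assumed to commute. $\mathbf 1$ is the identity matrix. Construction. For each ordered pair $(i,j)$ with $i\ne j$ fix a choice $k=k(j,i)$ with $r_k^i-r_k^j\in R^\times$, and put $$Z_i=\prod_{j\ne i}\frac{L_{k}-r_{k}^j\mathbf 1}{r_{k}^i-r_{k}^j}\qquad(k=k(j,i)),$$ the product being taken in any fixed order, and $\mathcal E_i=Z_i^d$ for $1\le i\le d$. Set $f^{(0)}_j=\mathcal E_j$ for $1\le j\le d$. For $l=0,1,\dots,d-1$ successively put $e_{l+1}=f^{(l)}_{l+1}$, $F_{l}=e_1+\dots+e_{l+1}$, and $f^{(l+1)}_j=(\mathbf 1-F_{l})f^{(l)}_j$ for $l+2\le j\le d$. This defines $e_1,\dots,e_d$. *)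

theory Defs
  imports "Jordan_Normal_Form.Matrix"
begin

text \<open>
  All indices are shifted down by one: \<open>L 0, \<dots>, L (n - 1)\<close> are the given matrices, \<open>{..<d}\<close> indexes
  rows and columns, and \<open>r\<^sub>k\<^sup>i\<close> is the diagonal entry \<open>L k $$ (i, i)\<close>.
\<close>

text \<open>The inverse of a unit; unspecified on non-units.\<close>
definition unit_inv :: "'a :: idom \<Rightarrow> 'a" where
  "unit_inv x = (THE y. x * y = 1)"

definition mat_prod_list :: "nat \<Rightarrow> 'a :: idom mat list \<Rightarrow> 'a mat" where
  "mat_prod_list d As = foldr (*) As (1\<^sub>m d)"

definition mat_sum_list :: "nat \<Rightarrow> 'a :: idom mat list \<Rightarrow> 'a mat" where
  "mat_sum_list d As = foldr (+) As (0\<^sub>m d d)"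

definition separates :: "(nat \<Rightarrow> 'a :: idom mat) \<Rightarrow> nat \<Rightarrow> nat \<Rightarrow> nat \<Rightarrow> bool" where
  "separates L k i j \<longleftrightarrow> (L k $$ (i, i) - L k $$ (j, j)) dvd 1"

definition separating_at :: "nat \<Rightarrow> nat \<Rightarrow> (nat \<Rightarrow> 'a :: idom mat) \<Rightarrow> nat \<Rightarrow> bool" where
  "separating_at n d L i \<longleftrightarrow> (\<forall>j \<in> {..<d} - {i}. \<exists>k<n. separates L k i j)"

text \<open>The choice \<open>\<kappa> j i\<close> stands for the index \<open>k(j, i)\<close>, with the arguments in that order.\<close>
definition separating_choice ::
    "nat \<Rightarrow> nat \<Rightarrow> (nat \<Rightarrow> 'a :: idom mat) \<Rightarrow> (nat \<Rightarrow> nat \<Rightarrow> nat) \<Rightarrow> bool" where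
  "separating_choice n d L \<kappa> \<longleftrightarrow>
     (\<forall>i<d. \<forall>j \<in> {..<d} - {i}. \<kappa> j i < n \<and> separates L (\<kappa> j i) i j)"

text \<open>\<open>ord i\<close> enumerates the \<open>j \<noteq> i\<close> in the order in which the factors of \<open>Z\<^sub>i\<close> are multiplied.\<close>
definition factor_order :: "nat \<Rightarrow> (nat \<Rightarrow> nat list) \<Rightarrow> bool" where
  "factor_order d ord \<longleftrightarrow> (\<forall>i<d. distinct (ord i) \<and> set (ord i) = {..<d} - {i})"

definition Z_factor :: "nat \<Rightarrow> (nat \<Rightarrow> 'a :: idom mat) \<Rightarrow> nat \<Rightarrow> nat \<Rightarrow> nat \<Rightarrow> 'a mat" where
  "Z_factor d L k i j =
     unit_inv (L k $$ (i, i) - L k $$ (j, j)) \<cdot>\<^sub>m (L k - L k $$ (j, j) \<cdot>\<^sub>m 1\<^sub>m d)"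

definition Z_mat :: "nat \<Rightarrow> (nat \<Rightarrow> 'a :: idom mat) \<Rightarrow> (nat \<Rightarrow> nat \<Rightarrow> nat) \<Rightarrow> (nat \<Rightarrow> nat list)
    \<Rightarrow> nat \<Rightarrow> 'a mat" where
  "Z_mat d L \<kappa> ord i = mat_prod_list d (map (\<lambda>j. Z_factor d L (\<kappa> j i) i j) (ord i))"

definition E_mat :: "nat \<Rightarrow> (nat \<Rightarrow> 'a :: idom mat) \<Rightarrow> (nat \<Rightarrow> nat \<Rightarrow> nat) \<Rightarrow> (nat \<Rightarrow> nat list)
    \<Rightarrow> nat \<Rightarrow> 'a mat" where
  "E_mat d L \<kappa> ord i = Z_mat d L \<kappa> ord i ^\<^sub>m d"

text \<open>
  \<open>f_mat d E l j\<close> is \<open>f\<^sup>(\<^sup>l\<^sup>)\<^sub>j\<close> started from \<open>f\<^sup>(\<^sup>0\<^sup>)\<^sub>j = E j\<close>. After the index shift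
  \<open>e\<^sub>m = f\<^sup>(\<^sup>m\<^sup>)\<^sub>m\<close> and \<open>F\<^sub>l = e\<^sub>0 + \<dots> + e\<^sub>l\<close>, which is the sum in the second equation.
  The recursion is not restricted to \<open>l < j\<close>; the \<open>e\<^sub>m\<close> with \<open>m < d\<close> depend
  only on values \<open>f\<^sup>(\<^sup>l\<^sup>)\<^sub>j\<close> with \<open>l \<le> j < d\<close>.
\<close>
fun f_mat :: "nat \<Rightarrow> (nat \<Rightarrow> 'a :: idom mat) \<Rightarrow> nat \<Rightarrow> nat \<Rightarrow> 'a mat" where
  "f_mat d E 0 j = E j"
| "f_mat d E (Suc l) j =
     (1\<^sub>m d - mat_sum_list d (map (\<lambda>m. f_mat d E m m) [0..<Suc l])) * f_mat d E l j"

definition e_mat :: "nat \<Rightarrow> (nat \<Rightarrow> 'a :: idom mat) \<Rightarrow> (nat \<Rightarrow> nat \<Rightarrow> nat) \<Rightarrow> (nat \<Rightarrow> nat list)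
    \<Rightarrow> nat \<Rightarrow> 'a mat" where
  "e_mat d L \<kappa> ord i = f_mat d (E_mat d L \<kappa> ord) i i"

definition complete_orthogonal_idempotents :: "nat \<Rightarrow> (nat \<Rightarrow> 'a :: idom mat) \<Rightarrow> bool" where
  "complete_orthogonal_idempotents d e \<longleftrightarrow>
     (\<forall>i<d. e i \<in> carrier_mat d d) \<and>
     (\<forall>i<d. e i * e i = e i) \<and>
     (\<forall>i<d. \<forall>j<d. i \<noteq> j \<longrightarrow> e i * e j = 0\<^sub>m d d) \<and>
     mat_sum_list d (map e [0..<d]) = 1\<^sub>m d"

end

theory Submission
  imports Defs
begin

text \<open>
  The column space of a matrix is compared with the standard flag
  \<open>V\<^sub>0 \<subset> V\<^sub>1 \<subset> \<dots> \<subset> V\<^sub>d\<close>, where \<open>V\<^sub>k\<close> is spanned by the first \<open>k\<close> basis vectors. An upper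
  triangular matrix preserves the flag, and it maps \<open>V\<^sub>k\<^sub>+\<^sub>1\<close> into \<open>V\<^sub>k\<close> as soon as its
  \<open>k\<close>-th diagonal entry vanishes (\<open>range_in_flag_step\<close>).

  The matrix \<open>Z\<^sub>i\<close> is upper triangular, and its diagonal is the \<open>i\<close>-th unit vector: the factor
  indexed by \<open>j\<close> has a zero at \<open>j\<close>, and every factor has a one at \<open>i\<close>. Hence \<open>Z\<^sub>i\<close> lowers every
  step of the flag except the one from \<open>V\<^sub>i\<^sub>+\<^sub>1\<close> to \<open>V\<^sub>i\<close>, which \<open>Z\<^sub>i - 1\<close> lowers. Descending from
  \<open>V\<^sub>d\<close> to \<open>V\<^sub>0\<close> uses \<open>d - 1\<close> factors \<open>Z\<^sub>i\<close> and one factor \<open>Z\<^sub>i - 1\<close>, so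
  \<open>Z\<^sub>i\<^sup>d = Z\<^sub>i\<^sup>d\<^sup>-\<^sup>1\<close>, and \<open>E\<^sub>i = Z\<^sub>i\<^sup>d\<close> is idempotent (\<open>diag_delta_power_idempotent\<close>). For
  \<open>i < j\<close> the matrix \<open>E\<^sub>i\<close> brings everything down to \<open>V\<^sub>i\<^sub>+\<^sub>1\<close>, and \<open>Z\<^sub>j\<close> lowers all the
  remaining steps, so \<open>E\<^sub>j E\<^sub>i = 0\<close> (\<open>diag_delta_powers_orthogonal\<close>). The product
  \<open>E\<^sub>i E\<^sub>j\<close> need not vanish; repairing this other half of orthogonality is the task of the recursion
  for \<open>f\<close>.

  The repair works for any idempotents with this one-sided orthogonality (locale
  \<open>semi_orthogonal_idempotents\<close>). The vanishing \<open>E\<^sub>j E\<^sub>i = 0\<close> for \<open>i < j\<close> passes to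
  \<open>E\<^sub>j e\<^sub>i = 0\<close>, hence \<open>E\<^sub>j\<close> absorbs all factors \<open>1 - F\<^sub>l\<close> with \<open>l < j\<close>. Writing
  \<open>e\<^sub>j = G E\<^sub>j\<close> with \<open>G\<close> the product of these factors, \<open>E\<^sub>j G = E\<^sub>j\<close> gives
  \<open>e\<^sub>j e\<^sub>j = e\<^sub>j\<close> and \<open>E\<^sub>j e\<^sub>i = 0\<close> gives \<open>e\<^sub>j e\<^sub>i = 0\<close>. In the other order,
  \<open>e\<^sub>i (1 - F\<^sub>j\<^sub>-\<^sub>1) = e\<^sub>i - e\<^sub>i = 0\<close> once the earlier elements are known to be orthogonal, and
  \<open>1 - F\<^sub>j\<^sub>-\<^sub>1\<close> is the leftmost factor of \<open>e\<^sub>j\<close>.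

  For completeness, the factors \<open>1 - F\<^sub>l\<close> with \<open>l < j\<close> have a one at the \<open>j\<close>-th diagonal position, so
  \<open>e\<^sub>j\<close> keeps the diagonal of \<open>E\<^sub>j\<close>. The complement of \<open>e\<^sub>0 + \<dots> + e\<^sub>d\<^sub>-\<^sub>1\<close> is then an
  idempotent with zero diagonal; it lowers every step of the flag and is therefore zero
  (\<open>upper_triangular_diag_0_idempotent\<close>).
\<close>

section \<open>Powers and differences of square matrices\<close>

lemma minus_zero_mat:
  fixes A :: "'a :: group_add mat"
  assumes "A \<in> carrier_mat d d"
  shows "A - 0\<^sub>m d d = A"
  using assms by (intro eq_matI) auto

lemma minus_mat_eq_0_imp_eq:
  fixes A B :: "'a :: group_add mat"
  assumes A: "A \<in> carrier_mat d d" and B: "B \<in> carrier_mat d d" and "A - B = 0\<^sub>m d d"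
  shows "A = B"
proof (rule eq_matI)
  fix a b assume "a < dim_row B" "b < dim_col B"
  then show "A $$ (a, b) = B $$ (a, b)"
    using arg_cong[OF assms(3), of "\<lambda>X. X $$ (a, b)"] A B by simp
qed (use A B in auto)

lemma pow_mat_add:
  fixes M :: "'a :: semiring_1 mat"
  assumes M: "M \<in> carrier_mat d d"
  shows "M ^\<^sub>m (a + b) = M ^\<^sub>m a * M ^\<^sub>m b"
proof (induction b)
  case (Suc b)
  then show ?case using M by (simp add: assoc_mult_mat[of _ d d _ d _ d])
qed (use M in simp)

section \<open>Diagonals of products of upper triangular matrices\<close>

lemma upper_triangular_mult_index:
  fixes A B :: "'a :: semiring_1 mat"
  assumes A: "A \<in> carrier_mat d d" "upper_triangular A"
    and B: "B \<in> carrier_mat d d" "upper_triangular B"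
  shows "upper_triangular (A * B)"
    and "a < d \<Longrightarrow> (A * B) $$ (a, a) = A $$ (a, a) * B $$ (a, a)"
proof -
  have entry: "(A * B) $$ (a, b) = (\<Sum>c<d. A $$ (a, c) * B $$ (c, b))" if "a < d" "b < d" for a b
    using that A(1) B(1) by (simp add: scalar_prod_def atLeast0LessThan)
  have zero: "A $$ (a, c) * B $$ (c, b) = 0" if "a < d" "c < d" "c < a \<or> b < c" for a b c
    using that(3)
  proof
    assume "c < a"
    then show ?thesis using that A upper_triangularD[of A c a] by simp
  next
    assume "b < c"
    then show ?thesis using that B upper_triangularD[of B b c] by simp
  qed
  show "upper_triangular (A * B)"
  proof
    fix a b assume "b < a" "a < dim_row (A * B)"
    then have "a < d" "b < d" "b < a" using A by auto
    moreover from this have "(\<Sum>c<d. A $$ (a, c) * B $$ (c, b)) = 0"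
      by (intro sum.neutral ballI zero) auto
    ultimately show "(A * B) $$ (a, b) = 0" by (simp add: entry)
  qed
  assume a: "a < d"
  have "(\<Sum>c<d. A $$ (a, c) * B $$ (c, a)) = (\<Sum>c\<in>{a}. A $$ (a, c) * B $$ (c, a))"
  proof (rule sum.mono_neutral_right)
    show "\<forall>c\<in>{..<d} - {a}. A $$ (a, c) * B $$ (c, a) = 0"
    proof
      fix c assume "c \<in> {..<d} - {a}"
      then show "A $$ (a, c) * B $$ (c, a) = 0" using a by (intro zero) auto
    qed
  qed (use a in auto)
  then show "(A * B) $$ (a, a) = A $$ (a, a) * B $$ (a, a)"
    using a by (simp add: entry)
qed

lemma pow_mat_diag:
  fixes M :: "'a :: semiring_1 mat"
  assumes "M \<in> carrier_mat d d" "upper_triangular M"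
  shows "upper_triangular (M ^\<^sub>m k) \<and> (\<forall>a<d. (M ^\<^sub>m k) $$ (a, a) = M $$ (a, a) ^ k)"
proof (induction k)
  case (Suc k)
  then show ?case
    using upper_triangular_mult_index[OF pow_carrier_mat[OF assms(1)] _ assms, of k]
    by (simp del: power_Suc add: power_Suc2)
qed (use assms in auto)

section \<open>Upper triangular matrices acting on the standard flag\<close>

text \<open>
  The columns of \<open>A\<close> lie in the span \<open>V\<^sub>k\<close> of the first \<open>k\<close> basis vectors.
\<close>

definition range_in_flag :: "nat \<Rightarrow> 'a :: zero mat \<Rightarrow> bool" where
  "range_in_flag k A \<longleftrightarrow> (\<forall>a<dim_row A. \<forall>b<dim_col A. k \<le> a \<longrightarrow> A $$ (a, b) = 0)"

lemma range_in_flag_0_iff: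
  assumes "A \<in> carrier_mat d d"
  shows "range_in_flag 0 A \<longleftrightarrow> A = 0\<^sub>m d d"
  using assms by (auto simp: range_in_flag_def intro!: eq_matI)

lemma range_in_flag_full: "A \<in> carrier_mat d d \<Longrightarrow> range_in_flag d A"
  by (auto simp: range_in_flag_def)

text \<open>
  The image of \<open>V\<^sub>k\<^sub>+\<^sub>1\<close> under \<open>M\<close> lies in \<open>V\<^sub>k\<^sub>+\<^sub>1\<close> by triangularity, and its \<open>k\<close>-th
  coordinates are multiples of \<open>M $$ (k, k)\<close>.
\<close>

lemma range_in_flag_step:
  fixes M A :: "'a :: ring_1 mat"
  assumes M: "M \<in> carrier_mat d d" "upper_triangular M" and A: "A \<in> carrier_mat d d"
    and k: "k < d" "M $$ (k, k) = 0" and range: "range_in_flag (Suc k) A"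
  shows "range_in_flag k (M * A)"
  unfolding range_in_flag_def
proof (intro allI impI)
  fix a b assume "a < dim_row (M * A)" "b < dim_col (M * A)" and ka: "k \<le> a"
  then have ab: "a < d" "b < d" using M A by auto
  have "M $$ (a, c) * A $$ (c, b) = 0" if "c < d" for c
  proof -
    consider "c < a" | "Suc k \<le> c" | "a = k" "c = k" using ka by linarith
    then have "M $$ (a, c) = 0 \<or> A $$ (c, b) = 0"
    proof cases
      case 1
      then show ?thesis using upper_triangularD[OF M(2)] M(1) ab by simp
    next
      case 2
      then show ?thesis using range A ab that by (simp add: range_in_flag_def)
    next
      case 3
      then show ?thesis using k by simp
    qed
    then show ?thesis by auto
  qed
  then show "(M * A) $$ (a, b) = 0"
    using ab M(1) A by (auto simp: scalar_prod_def intro!: sum.neutral)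
qed

lemma range_in_flag_power:
  fixes M A :: "'a :: ring_1 mat"
  assumes M: "M \<in> carrier_mat d d" "upper_triangular M"
    and A: "A \<in> carrier_mat d d" "range_in_flag (p + m) A"
    and "p + m \<le> d" and "\<And>k. p \<le> k \<Longrightarrow> k < p + m \<Longrightarrow> M $$ (k, k) = 0"
  shows "range_in_flag p (M ^\<^sub>m m * A)"
  using A assms(5,6)
proof (induction m arbitrary: A)
  case 0
  then show ?case using M by simp
next
  case (Suc m)
  have "range_in_flag (p + m) (M * A)"
    using Suc.prems M by (intro range_in_flag_step[where d = d]) auto
  then have "range_in_flag p (M ^\<^sub>m m * (M * A))"
    using Suc.prems M by (intro Suc.IH) auto
  then show ?case
    using M Suc.prems by (simp add: assoc_mult_mat[of _ d d _ d _ d])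
qed

text \<open>
  All of \<open>V\<^sub>d\<close> descends, one step for each factor, down to \<open>V\<^sub>i\<^sub>+\<^sub>1\<close>, where the diagonal entry
  of \<open>M\<close> for the next step may be nonzero.
\<close>

lemma range_in_flag_diag_delta_power:
  fixes M :: "'a :: ring_1 mat"
  assumes M: "M \<in> carrier_mat d d" "upper_triangular M" and i: "i < d"
    and diag: "\<And>k. k < d \<Longrightarrow> k \<noteq> i \<Longrightarrow> M $$ (k, k) = 0"
  shows "range_in_flag (Suc i) (M ^\<^sub>m (d - Suc i))"
proof -
  have "range_in_flag (Suc i) (M ^\<^sub>m (d - Suc i) * 1\<^sub>m d)"
    using i M diag by (intro range_in_flag_power[where d = d] range_in_flag_full) (auto simp: range_in_flag_full)
  then show ?thesis using M by simp
qed

text \<open>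
  Over a commutative ring the characteristic polynomial of \<open>M\<close> is \<open>X\<^sup>d\<^sup>-\<^sup>1 (X - 1)\<close>, so this is the Cayley-Hamilton theorem
  in a case where it follows from the flag: the factors in \<open>M\<^sup>i (M - 1) M\<^sup>d\<^sup>-\<^sup>1\<^sup>-\<^sup>i\<close> are
  arranged so that each of them meets the step of the flag that it lowers. The resulting
  \<open>M\<^sup>d = M\<^sup>d\<^sup>-\<^sup>1\<close> makes all later powers equal.
\<close>

lemma diag_delta_power_idempotent:
  fixes M :: "'a :: ring_1 mat"
  assumes M: "M \<in> carrier_mat d d" "upper_triangular M" and i: "i < d"
    and one: "M $$ (i, i) = 1" and diag: "\<And>k. k < d \<Longrightarrow> k \<noteq> i \<Longrightarrow> M $$ (k, k) = 0"
  shows "M ^\<^sub>m d * M ^\<^sub>m d = M ^\<^sub>m d"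
proof -
  note [simp] = pow_carrier_mat[OF M(1)] M(1)
  define P where "P = M ^\<^sub>m (d - Suc i)"
  have P[simp]: "P \<in> carrier_mat d d" by (simp add: P_def)
  have MP: "M * P = M ^\<^sub>m (Suc (d - Suc i))"
    using pow_mat_add[OF M(1), of 1 "d - Suc i"] M(1) by (simp add: P_def)
  have "upper_triangular (M - 1\<^sub>m d)"
    using M(2) carrier_matD[OF M(1)] by (auto simp: upper_triangular_def)
  moreover have [simp]: "(M - 1\<^sub>m d) * P \<in> carrier_mat d d"
    by (intro mult_carrier_mat[of _ d d] minus_carrier_mat) simp_all
  ultimately have "range_in_flag i ((M - 1\<^sub>m d) * P)"
    using M i one range_in_flag_diag_delta_power[OF M i diag]
    by (intro range_in_flag_step[where d = d]) (auto simp: P_def)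
  then have "range_in_flag 0 (M ^\<^sub>m i * ((M - 1\<^sub>m d) * P))"
    using M i diag by (intro range_in_flag_power[where d = d]) auto
  then have "0\<^sub>m d d = M ^\<^sub>m i * ((M - 1\<^sub>m d) * P)"
    by (subst (asm) range_in_flag_0_iff[of _ d]) (auto intro!: mult_carrier_mat[of _ d d])
  also have "\<dots> = M ^\<^sub>m i * (M * P) - M ^\<^sub>m i * P"
    by (simp add: minus_mult_distrib_mat[of _ d d _ _ d] left_mult_one_mat[OF P]
        mult_minus_distrib_mat[of _ d d _ d] mult_carrier_mat[of _ d d])
  also have "M ^\<^sub>m i * P = M ^\<^sub>m (d - 1)"
    using i by (simp add: P_def flip: pow_mat_add[OF M(1)])
  also have "M ^\<^sub>m i * (M * P) = M ^\<^sub>m d"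
    unfolding MP using i by (simp flip: pow_mat_add[OF M(1)] pow_mat.simps)
  finally have eq0: "0\<^sub>m d d = M ^\<^sub>m d - M ^\<^sub>m (d - 1)" .
  have eq: "M ^\<^sub>m d = M ^\<^sub>m (d - 1)"
    by (rule minus_mat_eq_0_imp_eq[OF _ _ eq0[symmetric]]) auto
  have "M ^\<^sub>m (d + m) = M ^\<^sub>m d" for m
  proof (induction m)
    case (Suc m)
    have "M ^\<^sub>m (d + Suc m) = M ^\<^sub>m d * M" using Suc by simp
    also have "\<dots> = M ^\<^sub>m (d - 1) * M" by (simp only: eq)
    also have "\<dots> = M ^\<^sub>m d" using i by (simp flip: pow_mat.simps)
    finally show ?case .
  qed simp
  then show ?thesis by (simp flip: pow_mat_add[OF M(1)])
qed

text \<open>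
  Only \<open>d - 1 - i\<close> factors of \<open>N\<close> are needed to reach \<open>V\<^sub>i\<^sub>+\<^sub>1\<close>, and \<open>i + 1\<close> factors of \<open>M\<close> then
  reach \<open>V\<^sub>0\<close>, because \<open>i < j\<close> makes the diagonal of \<open>M\<close> vanish at the positions up to \<open>i\<close>.
\<close>

lemma diag_delta_powers_orthogonal:
  fixes M N :: "'a :: ring_1 mat"
  assumes M: "M \<in> carrier_mat d d" "upper_triangular M"
    and N: "N \<in> carrier_mat d d" "upper_triangular N" and ij: "i < j" "j < d"
    and diagM: "\<And>k. k < d \<Longrightarrow> k \<noteq> j \<Longrightarrow> M $$ (k, k) = 0"
    and diagN: "\<And>k. k < d \<Longrightarrow> k \<noteq> i \<Longrightarrow> N $$ (k, k) = 0"
  shows "M ^\<^sub>m d * N ^\<^sub>m d = 0\<^sub>m d d"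
proof -
  note [simp] = pow_carrier_mat[OF M(1)] pow_carrier_mat[OF N(1)] M(1) N(1)
  define P where "P = N ^\<^sub>m (d - Suc i)"
  have P[simp]: "P \<in> carrier_mat d d" by (simp add: P_def)
  have "range_in_flag (Suc i) P"
    unfolding P_def using N ij diagN by (intro range_in_flag_diag_delta_power) auto
  then have "range_in_flag 0 (M ^\<^sub>m (Suc i) * P)"
    using M ij diagM by (intro range_in_flag_power[where d = d]) auto
  then have zero: "M ^\<^sub>m (Suc i) * P = 0\<^sub>m d d"
    by (subst (asm) range_in_flag_0_iff[of _ d]) (auto simp del: pow_mat.simps intro!: mult_carrier_mat[of _ d d])
  have "M ^\<^sub>m d * N ^\<^sub>m d = (M ^\<^sub>m (d - Suc i) * M ^\<^sub>m (Suc i)) * (P * N ^\<^sub>m (Suc i))"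
    using ij unfolding P_def by (simp del: pow_mat.simps flip: pow_mat_add[OF M(1)] pow_mat_add[OF N(1)])
  also have "\<dots> = M ^\<^sub>m (d - Suc i) * ((M ^\<^sub>m (Suc i) * P) * N ^\<^sub>m (Suc i))"
    by (simp del: pow_mat.simps add: assoc_mult_mat[of _ d d _ d _ d] mult_carrier_mat[of _ d d _ d])
  also have "\<dots> = 0\<^sub>m d d" 
    by (simp del: pow_mat.simps add: zero left_mult_zero_mat[of _ d d] right_mult_zero_mat[of _ d d])
  finally show ?thesis .
qed

text \<open>
  Replacing \<open>N\<close> by \<open>N * N\<close> lowers its column space by one step of the flag, as often as desired.
\<close>

lemma upper_triangular_diag_0_idempotent:
  fixes N :: "'a :: ring_1 mat"
  assumes N: "N \<in> carrier_mat d d" "upper_triangular N"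
    and "\<And>k. k < d \<Longrightarrow> N $$ (k, k) = 0" and idem: "N * N = N"
  shows "N = 0\<^sub>m d d"
proof -
  \<comment> \<open>Truncated subtraction keeps the claim stationary once the bottom of the flag is reached.\<close>
  have "range_in_flag (d - m) N" for m
  proof (induction m)
    case 0
    then show ?case using N by (simp add: range_in_flag_full)
  next
    case (Suc m)
    show ?case
    proof (cases "m < d")
      case True
      then have "range_in_flag (d - Suc m) (N * N)"
        using Suc assms by (intro range_in_flag_step[where d = d]) (auto simp: Suc_diff_Suc)
      then show ?thesis by (simp add: idem)
    qed (use Suc in simp)
  qed
  from this[of d] show ?thesis using N by (simp add: range_in_flag_0_iff)
qed

section \<open>Sums of lists of matrices\<close>

lemma mat_sum_list_carrier [simp]: "mat_sum_list d As \<in> carrier_mat d d"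
  by (induction As) (auto simp: mat_sum_list_def)

lemma mat_sum_list_dim [simp]:
  "dim_row (mat_sum_list d As) = d" "dim_col (mat_sum_list d As) = d"
  using carrier_matD[OF mat_sum_list_carrier] by auto

lemma mat_sum_list_Nil [simp]: "mat_sum_list d [] = 0\<^sub>m d d"
  and mat_sum_list_Cons [simp]: "mat_sum_list d (A # As) = A + mat_sum_list d As"
  by (simp_all add: mat_sum_list_def)

lemma mult_mat_sum_list:
  assumes "M \<in> carrier_mat d d" "\<And>x. x \<in> set xs \<Longrightarrow> g x \<in> carrier_mat d d"
  shows "M * mat_sum_list d (map g xs) = mat_sum_list d (map (\<lambda>x. M * g x) xs)"
  using assms by (induction xs) (auto simp: mult_add_distrib_mat[of _ d d _ d])

lemma mat_sum_list_mult:
  assumes "M \<in> carrier_mat d d" "\<And>x. x \<in> set xs \<Longrightarrow> g x \<in> carrier_mat d d"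
  shows "mat_sum_list d (map g xs) * M = mat_sum_list d (map (\<lambda>x. g x * M) xs)"
  using assms by (induction xs) (auto simp: add_mult_distrib_mat[of _ d d _ _ d])

lemma mat_sum_list_neutral:
  "(\<And>x. x \<in> set xs \<Longrightarrow> g x = 0\<^sub>m d d) \<Longrightarrow> mat_sum_list d (map g xs) = 0\<^sub>m d d"
  by (induction xs) auto

lemma mat_sum_list_delta:
  assumes "A \<in> carrier_mat d d"
  shows "distinct xs \<Longrightarrow> i \<in> set xs \<Longrightarrow> 
    mat_sum_list d (map (\<lambda>x. if x = i then A else 0\<^sub>m d d) xs) = A"
proof (induction xs)
  case (Cons x xs)
  show ?case
  proof (cases "x = i")
    case True
    then have "mat_sum_list d (map (\<lambda>x. if x = i then A else 0\<^sub>m d d) xs) = 0\<^sub>m d d"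
      using Cons.prems by (intro mat_sum_list_neutral) auto
    then show ?thesis using True assms by simp
  next
    case False
    then have "mat_sum_list d (map (\<lambda>x. if x = i then A else 0\<^sub>m d d) xs) = A"
      using Cons by simp
    then show ?thesis using False assms by simp
  qed
qed simp

lemma mat_sum_list_index:
  assumes "a < d" "b < d"
  shows "(\<And>x. x \<in> set xs \<Longrightarrow> g x \<in> carrier_mat d d) \<Longrightarrow>
    mat_sum_list d (map g xs) $$ (a, b) = (\<Sum>x\<leftarrow>xs. g x $$ (a, b))"
proof (induction xs)
  case (Cons x xs)
  then show ?case
    using assms carrier_matD[OF mat_sum_list_carrier[of d "map g xs"]] by simp
qed (use assms in simp)

section \<open>Orthogonalizing one-sidedly orthogonal idempotents\<close>

locale semi_orthogonal_idempotents =
  fixes d m :: nat and E :: "nat \<Rightarrow> 'a :: idom mat"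
  assumes E_carrier: "j < m \<Longrightarrow> E j \<in> carrier_mat d d"
    and E_idem: "j < m \<Longrightarrow> E j * E j = E j"
    and E_orth: "i < j \<Longrightarrow> j < m \<Longrightarrow> E j * E i = 0\<^sub>m d d"
begin

abbreviation f :: "nat \<Rightarrow> nat \<Rightarrow> 'a mat" where "f \<equiv> f_mat d E"
abbreviation e :: "nat \<Rightarrow> 'a mat" where "e j \<equiv> f j j"
abbreviation S :: "nat \<Rightarrow> 'a mat" where "S l \<equiv> mat_sum_list d (map (\<lambda>m. f m m) [0..<l])"

lemma f_Suc: "f (Suc l) j = (1\<^sub>m d - S (Suc l)) * f l j"
  by simp

declare f_mat.simps(2) [simp del]

lemma f_carrier: "j < m \<Longrightarrow> f l j \<in> carrier_mat d d"
  by (induction l) (auto simp: E_carrier f_Suc simp del: upt_Suc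
      intro!: mult_carrier_mat[of _ d d] minus_carrier_mat)

text \<open>
  The recursion unfolded under a left factor \<open>X\<close>, for matrices \<open>X\<close> whose product with
  \<open>S (Suc l)\<close> is known: in the applications it is either zero or \<open>X\<close> itself.
\<close>

lemma mult_f_Suc:
  assumes X: "X \<in> carrier_mat d d" and j: "j < m"
  shows "X * f (Suc l) j = X * f l j - X * S (Suc l) * f l j"
proof -
  have "X * f (Suc l) j = X * (f l j - S (Suc l) * f l j)"
    unfolding f_Suc using f_carrier[OF j, of l]
    by (simp add: minus_mult_distrib_mat[of _ d d _ _ d] del: upt_Suc)
  also have "\<dots> = X * f l j - X * (S (Suc l) * f l j)"
    using X f_carrier[OF j, of l] by (intro mult_minus_distrib_mat mult_carrier_mat) auto
  also have "X * (S (Suc l) * f l j) = X * S (Suc l) * f l j"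
    using X f_carrier[OF j, of l] by (intro assoc_mult_mat[symmetric]) auto
  finally show ?thesis .
qed

text \<open>
  A left factor that annihilates the earlier \<open>e k\<close> absorbs every factor \<open>1 - S (Suc k)\<close> in
  \<open>f l j\<close>.
\<close>

lemma mult_f_eq:
  assumes X: "X \<in> carrier_mat d d" and j: "j < m"
    and "\<And>k. k < l \<Longrightarrow> X * e k = 0\<^sub>m d d" and "l \<le> j"
  shows "X * f l j = X * E j"
  using assms(3,4)
proof (induction l)
  case (Suc l)
  have "X * S (Suc l) = 0\<^sub>m d d"
    using Suc.prems X f_carrier j
    by (subst mult_mat_sum_list) (auto intro!: mat_sum_list_neutral simp del: upt_Suc)
  moreover have "X * f l j \<in> carrier_mat d d" using X f_carrier j by auto
  ultimately show ?case
    using Suc f_carrier[OF j, of l] by (simp add: mult_f_Suc[OF X j] minus_zero_mat del: upt_Suc)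
qed simp

lemma E_mult_e:
  assumes "i < j" "j < m"
  shows "E j * e i = 0\<^sub>m d d"
  using assms
proof (induction i rule: less_induct)
  case (less i)
  then have "E j * e i = E j * E i" 
    by (intro mult_f_eq) (auto simp: E_carrier)
  then show ?case using less E_orth by simp
qed

text \<open>
  Since \<open>f l j\<close> is a left multiple of \<open>E j\<close>, its right products are determined by those of \<open>E j\<close>.
\<close>

lemma f_mult_cong:
  assumes "j < m" "X \<in> carrier_mat d d" "Y \<in> carrier_mat d d" "E j * X = E j * Y"
  shows "f l j * X = f l j * Y"
proof (induction l)
  case (Suc l)
  have "f (Suc l) j * X = (1\<^sub>m d - S (Suc l)) * (f l j * X)" if "X \<in> carrier_mat d d" for X
    unfolding f_Suc using that f_carrier[OF assms(1)]
    by (intro assoc_mult_mat[of _ d d _ d _ d] minus_carrier_mat mat_sum_list_carrier)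
  then show ?case using Suc assms by simp
qed (simp add: assms)

lemma e_idem:
  assumes "j < m"
  shows "e j * e j = e j"
proof -
  have "E j * e j = E j * E j"
    using assms by (intro mult_f_eq E_mult_e) (auto simp: E_carrier)
  then have "E j * e j = E j * 1\<^sub>m d" using assms E_carrier[OF assms] by (simp add: E_idem)
  then have "e j * e j = e j * 1\<^sub>m d" 
    using assms by (intro f_mult_cong) (auto simp: f_carrier)
  then show ?thesis using f_carrier[OF assms, of j] by simp
qed

lemma e_orth_lower:
  assumes "i < j" "j < m"
  shows "e j * e i = 0\<^sub>m d d"
proof -
  have "E j * e i = E j * 0\<^sub>m d d" using E_mult_e[OF assms] E_carrier[OF assms(2)] by simp
  then have "e j * e i = e j * 0\<^sub>m d d" 
    using assms by (intro f_mult_cong) (auto simp: f_carrier)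
  then show ?thesis using f_carrier[OF assms(2), of j] by simp
qed

text \<open>
  Orthogonality is assumed only below \<open>l\<close> so that the lemma can serve inside the induction that proves
  orthogonality.
\<close>

lemma e_mult_S:
  assumes "\<And>k. k < l \<Longrightarrow> k \<noteq> i \<Longrightarrow> e i * e k = 0\<^sub>m d d" "i < l" "l \<le> m"
  shows "e i * S l = e i"
proof -
  have "e i * S l = mat_sum_list d (map (\<lambda>k. e i * e k) [0..<l])"
    using assms by (intro mult_mat_sum_list) (auto simp: f_carrier)
  also have "map (\<lambda>k. e i * e k) [0..<l] = map (\<lambda>k. if k = i then e i else 0\<^sub>m d d) [0..<l]"
    using assms e_idem by auto
  also have "mat_sum_list d \<dots> = e i"
    using assms by (intro mat_sum_list_delta) (auto simp: f_carrier)
  finally show ?thesis .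
qed

text \<open>
  The leftmost factor of \<open>e j\<close> is \<open>1 - S j\<close>, and \<open>e i\<close> annihilates it because
  \<open>e i * S j = e i\<close>. This uses two-sided orthogonality among the elements before \<open>j\<close>, which is what the
  induction on \<open>j\<close> supplies.
\<close>

lemma e_orth_upper:
  assumes "i < j" "j < m"
  shows "e i * e j = 0\<^sub>m d d"
  using assms
proof (induction j arbitrary: i rule: less_induct)
  case (less j)
  then obtain l where l: "j = Suc l" by (cases j) auto
  have "e i * e k = 0\<^sub>m d d" if "k < j" "k \<noteq> i" for k
    using that less e_orth_lower[of k i] by (cases "k < i") auto
  then have "e i * S j = e i" using less by (intro e_mult_S) auto
  then have "e i * f (Suc l) j = e i * f l j - e i * f l j"
    using less.prems by (subst mult_f_Suc) (auto simp: f_carrier l simp del: upt_Suc)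
  also have "\<dots> = 0\<^sub>m d d"
    using less.prems f_carrier[of i i] f_carrier[of j l] by (intro minus_r_inv_mat mult_carrier_mat) auto
  finally show ?case by (simp add: l)
qed

lemma e_orth: "i < m \<Longrightarrow> j < m \<Longrightarrow> i \<noteq> j \<Longrightarrow> e i * e j = 0\<^sub>m d d"
  using e_orth_lower e_orth_upper by (cases i j rule: linorder_cases) auto

lemma S_idem: "S m * S m = S m"
proof -
  have "S m * S m = mat_sum_list d (map (\<lambda>k. e k * S m) [0..<m])"
    by (intro mat_sum_list_mult) (auto simp: f_carrier)
  also have "map (\<lambda>k. e k * S m) [0..<m] = map e [0..<m]"
    by (auto intro!: e_mult_S e_orth)
  finally show ?thesis .
qed

lemma complement_S_idem: "(1\<^sub>m d - S m) * (1\<^sub>m d - S m) = 1\<^sub>m d - S m"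
proof -
  have "(1\<^sub>m d - S m) * (1\<^sub>m d - S m) = (1\<^sub>m d - S m) - S m * (1\<^sub>m d - S m)"
    by (subst minus_mult_distrib_mat[of _ d d _ _ d])
      (auto intro!: minus_carrier_mat simp: left_mult_one_mat[of _ d d])
  also have "S m * (1\<^sub>m d - S m) = S m - S m"
    by (subst mult_minus_distrib_mat[of _ d d _ d]) (auto simp: S_idem)
  also have "S m - S m = 0\<^sub>m d d" by (rule minus_r_inv_mat) simp
  also have "(1\<^sub>m d - S m) - 0\<^sub>m d d = 1\<^sub>m d - S m"
    by (intro minus_zero_mat minus_carrier_mat) simp
  finally show ?thesis .
qed

end

section \<open>Completeness by comparing diagonals\<close>

lemma mat_sum_list_delta_diag:
  fixes g :: "nat \<Rightarrow> 'a :: idom mat"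
  assumes "\<And>k. k < l \<Longrightarrow> g k \<in> carrier_mat d d"
    and "\<And>k. k < l \<Longrightarrow> upper_triangular (g k)"
    and "\<And>k a. k < l \<Longrightarrow> a < d \<Longrightarrow> g k $$ (a, a) = (if a = k then 1 else 0)"
  shows "upper_triangular (1\<^sub>m d - mat_sum_list d (map g [0..<l]))"
    and "a < d \<Longrightarrow> (1\<^sub>m d - mat_sum_list d (map g [0..<l])) $$ (a, a) = (if a < l then 0 else 1)"
proof -
  let ?S = "mat_sum_list d (map g [0..<l])"
  have dim: "dim_row ?S = d" "dim_col ?S = d" using carrier_matD[OF mat_sum_list_carrier] by auto
  have ix: "?S $$ (a, b) = (\<Sum>k<l. g k $$ (a, b))" if "a < d" "b < d" for a b
    using that assms(1) by (subst mat_sum_list_index)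
      (auto simp: interv_sum_list_conv_sum_set_nat atLeast0LessThan)
  show "upper_triangular (1\<^sub>m d - ?S)"
  proof
    fix a b assume ba: "b < a" "a < dim_row (1\<^sub>m d - ?S)"
    have "g k $$ (a, b) = 0" if "k < l" for k
      using assms(1,2)[OF that] ba dim by auto
    then show "(1\<^sub>m d - ?S) $$ (a, b) = 0" using ba dim by (simp add: ix)
  qed
  assume a: "a < d"
  show "(1\<^sub>m d - ?S) $$ (a, a) = (if a < l then 0 else 1)"
    using a dim by (simp add: ix assms(3) sum.delta)
qed

text \<open>
  The factor \<open>1 - (e\<^sub>0 + \<dots> + e\<^sub>k)\<close> with \<open>k < l \<le> j\<close> has diagonal entry one at \<open>j\<close>, and elsewhere
  \<open>E j\<close> contributes a zero. Knowing the diagonal of this factor requires the statement for all smaller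
  \<open>l\<close> and every \<open>j\<close>, hence the strong induction.
\<close>

lemma f_mat_diag:
  fixes E :: "nat \<Rightarrow> 'a :: idom mat"
  assumes E: "\<And>j. j < m \<Longrightarrow> E j \<in> carrier_mat d d" "\<And>j. j < m \<Longrightarrow> upper_triangular (E j)"
    "\<And>j a. j < m \<Longrightarrow> a < d \<Longrightarrow> E j $$ (a, a) = (if a = j then 1 else 0)"
  shows "l \<le> j \<Longrightarrow> j < m \<Longrightarrow> f_mat d E l j \<in> carrier_mat d d \<and> upper_triangular (f_mat d E l j) \<and>
    (\<forall>a<d. f_mat d E l j $$ (a, a) = (if a = j then 1 else 0))"
proof (induction l arbitrary: j rule: less_induct)
  case (less l)
  show ?case
  proof (cases l)
    case 0
    then show ?thesis using less.prems E by simp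
  next
    case (Suc l')
    define N where "N = 1\<^sub>m d - mat_sum_list d (map (\<lambda>m. f_mat d E m m) [0..<Suc l'])"
    have N: "N \<in> carrier_mat d d" unfolding N_def by (intro minus_carrier_mat) simp
    have IH: "f_mat d E k k \<in> carrier_mat d d" "upper_triangular (f_mat d E k k)"
      "a < d \<Longrightarrow> f_mat d E k k $$ (a, a) = (if a = k then 1 else 0)" if "k < Suc l'" for k a
      using less.IH[of k k] that less.prems Suc by auto
    have N': "upper_triangular N" "a < d \<Longrightarrow> N $$ (a, a) = (if a < Suc l' then 0 else 1)" for a
      unfolding N_def by (intro mat_sum_list_delta_diag IH; assumption)+
    have F: "f_mat d E l' j \<in> carrier_mat d d" "upper_triangular (f_mat d E l' j)"
      "\<And>a. a < d \<Longrightarrow> f_mat d E l' j $$ (a, a) = (if a = j then 1 else 0)"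
      using less.IH[of l' j] less.prems Suc by auto
    have "f_mat d E l j = N * f_mat d E l' j" by (simp add: Suc N_def)
    then show ?thesis
      using upper_triangular_mult_index[OF N N'(1) F(1,2)] N F N'(2) less.prems Suc by auto
  qed
qed

text \<open>
  The complement of the sum is an idempotent, and its diagonal vanishes because the diagonals of the
  \<open>e j\<close> are the \<open>d\<close> unit vectors.
\<close>

lemma semi_orthogonal_triangular_complete:
  fixes E :: "nat \<Rightarrow> 'a :: idom mat"
  assumes "semi_orthogonal_idempotents d d E" "\<And>j. j < d \<Longrightarrow> upper_triangular (E j)"
    "\<And>j a. j < d \<Longrightarrow> a < d \<Longrightarrow> E j $$ (a, a) = (if a = j then 1 else 0)"
  shows "complete_orthogonal_idempotents d (\<lambda>j. f_mat d E j j)"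
proof -
  interpret semi_orthogonal_idempotents d d E by fact
  have props: "e j \<in> carrier_mat d d" "upper_triangular (e j)"
    "a < d \<Longrightarrow> e j $$ (a, a) = (if a = j then 1 else 0)" if "j < d" for j a
    using f_mat_diag[of d E d j j] E_carrier assms(2,3) that by auto
  have "1\<^sub>m d - S d = 0\<^sub>m d d"
  proof (rule upper_triangular_diag_0_idempotent)
    show "upper_triangular (1\<^sub>m d - S d)"
      by (intro mat_sum_list_delta_diag props; assumption)
    show "(1\<^sub>m d - S d) $$ (k, k) = 0" if "k < d" for k
      using that by (subst mat_sum_list_delta_diag) (auto simp: props)
  qed (auto intro!: complement_S_idem minus_carrier_mat)
  then have "1\<^sub>m d = S d"
    by (rule minus_mat_eq_0_imp_eq[rotated 2]) (rule one_carrier_mat, rule mat_sum_list_carrier)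
  then show ?thesis
    unfolding complete_orthogonal_idempotents_def by (auto simp: props e_idem e_orth)
qed

section \<open>The diagonals of the matrices \<open>Z\<^sub>i\<close>\<close>

lemma unit_inv_mult:
  fixes x :: "'a :: idom"
  assumes "x dvd 1"
  shows "unit_inv x * x = 1"
proof -
  obtain y where y: "x * y = 1" using assms by (metis dvdE)
  have "unit_inv x = y"
    unfolding unit_inv_def
  proof (rule the_equality)
    fix z assume "x * z = 1"
    then have "x * z = x * y" "x \<noteq> 0" using y by auto
    then show "z = y" by simp
  qed (rule y)
  then show ?thesis using y by (simp add: mult.commute)
qed

lemma mat_prod_list_diag:
  fixes g :: "'b \<Rightarrow> 'a :: idom mat"
  assumes "\<And>x. x \<in> set xs \<Longrightarrow> g x \<in> carrier_mat d d" "\<And>x. x \<in> set xs \<Longrightarrow> upper_triangular (g x)"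
  shows "mat_prod_list d (map g xs) \<in> carrier_mat d d \<and> upper_triangular (mat_prod_list d (map g xs)) \<and>
    (\<forall>a<d. mat_prod_list d (map g xs) $$ (a, a) = (\<Prod>x\<leftarrow>xs. g x $$ (a, a)))"
  using assms
proof (induction xs)
  case Nil
  then show ?case by (auto simp: mat_prod_list_def)
next
  case (Cons x xs)
  let ?P = "mat_prod_list d (map g xs)"
  have P: "?P \<in> carrier_mat d d" "upper_triangular ?P"
    "\<And>a. a < d \<Longrightarrow> ?P $$ (a, a) = (\<Prod>x\<leftarrow>xs. g x $$ (a, a))"
    using Cons by auto
  have "g x \<in> carrier_mat d d" "upper_triangular (g x)" using Cons by auto
  note * = this
  have "mat_prod_list d (map g (x # xs)) = g x * ?P" by (simp add: mat_prod_list_def)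
  then show ?case using upper_triangular_mult_index[OF * P(1,2)] * P by auto
qed

text \<open>
  The normalization by \<open>unit_inv\<close> makes each factor one at position \<open>i\<close>, and the factor for \<open>j\<close> has a
  zero at position \<open>j\<close>; as \<open>ord i\<close> runs through all \<open>j \<noteq> i\<close>, only position \<open>i\<close> survives.
\<close>

lemma Z_mat_diag:
  fixes L :: "nat \<Rightarrow> 'a :: idom mat"
  assumes L: "\<And>k. k < n \<Longrightarrow> L k \<in> carrier_mat d d" "\<And>k. k < n \<Longrightarrow> upper_triangular (L k)"
    and \<kappa>: "separating_choice n d L \<kappa>" and ord: "factor_order d ord" and i: "i < d"
  shows "Z_mat d L \<kappa> ord i \<in> carrier_mat d d" "upper_triangular (Z_mat d L \<kappa> ord i)"
    "a < d \<Longrightarrow> Z_mat d L \<kappa> ord i $$ (a, a) = (if a = i then 1 else 0)"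
proof -
  let ?g = "\<lambda>j. Z_factor d L (\<kappa> j i) i j"
  have set: "set (ord i) = {..<d} - {i}" using ord i by (auto simp: factor_order_def)
  have k: "\<kappa> j i < n" "separates L (\<kappa> j i) i j" if "j \<in> set (ord i)" for j
    using \<kappa> i that by (auto simp: separating_choice_def set)
  have carr: "?g j \<in> carrier_mat d d" if "j \<in> set (ord i)" for j
    using L(1)[OF k(1)[OF that]] by (auto simp: Z_factor_def)
  have ut: "upper_triangular (?g j)" if "j \<in> set (ord i)" for j
    using L(1)[OF k(1)[OF that]] L(2)[OF k(1)[OF that]]
    by (auto simp: Z_factor_def upper_triangular_def)
  have diag: "?g j $$ (a, a) = unit_inv (L (\<kappa> j i) $$ (i, i) - L (\<kappa> j i) $$ (j, j)) *
      (L (\<kappa> j i) $$ (a, a) - L (\<kappa> j i) $$ (j, j))" if "j \<in> set (ord i)" "a < d" for j a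
    using L(1)[OF k(1)[OF that(1)]] that by (auto simp: Z_factor_def)
  note * = mat_prod_list_diag[of "ord i" ?g d, OF carr ut, folded Z_mat_def]
  show "Z_mat d L \<kappa> ord i \<in> carrier_mat d d" "upper_triangular (Z_mat d L \<kappa> ord i)"
    using * by blast+
  assume a: "a < d"
  have prod: "Z_mat d L \<kappa> ord i $$ (a, a) = (\<Prod>j\<leftarrow>ord i. ?g j $$ (a, a))"
    using * a by blast
  show "Z_mat d L \<kappa> ord i $$ (a, a) = (if a = i then 1 else 0)"
  proof (cases "a = i")
    case True
    have "?g j $$ (a, a) = 1" if "j \<in> set (ord i)" for j
      using diag[OF that a] k(2)[OF that] True by (simp add: unit_inv_mult separates_def)
    then have "map (\<lambda>j. ?g j $$ (a, a)) (ord i) = map (\<lambda>j. 1) (ord i)" by simp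
    then show ?thesis using True prod by (simp only: map_replicate_const prod_list_replicate) simp
  next
    case False
    then have "a \<in> set (ord i)" using a set by simp
    moreover have "?g a $$ (a, a) = 0" using diag[OF calculation a] by simp
    ultimately show ?thesis using False by (force simp: prod prod_list_zero_iff)
  qed
qed

theorem proposition4p2:
  fixes L :: "nat \<Rightarrow> 'a :: idom mat" and n d :: nat
  assumes "\<And>k. k < n \<Longrightarrow> L k \<in> carrier_mat d d"
    and "\<And>k. k < n \<Longrightarrow> upper_triangular (L k)"
    and "\<And>i. i < d \<Longrightarrow> separating_at n d L i"
  shows "(\<exists>\<kappa>. separating_choice n d L \<kappa>) \<and>
    (\<forall>\<kappa> ord. separating_choice n d L \<kappa> \<longrightarrow> factor_order d ord \<longrightarrow>
       complete_orthogonal_idempotents d (e_mat d L \<kappa> ord))"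
proof (intro conjI allI impI)
  have "\<forall>j i. \<exists>k. i < d \<longrightarrow> j \<in> {..<d} - {i} \<longrightarrow> k < n \<and> separates L k i j"
    using assms(3) unfolding separating_at_def by blast
  then have "\<exists>\<kappa>. \<forall>j i. i < d \<longrightarrow> j \<in> {..<d} - {i} \<longrightarrow> \<kappa> j i < n \<and> separates L (\<kappa> j i) i j"
    by (simp only: choice_iff)
  then show "\<exists>\<kappa>. separating_choice n d L \<kappa>"
    unfolding separating_choice_def by blast
next
  fix \<kappa> ord
  assume \<kappa>: "separating_choice n d L \<kappa>" and ord: "factor_order d ord"
  note Z = Z_mat_diag[OF assms(1,2) \<kappa> ord]
  let ?E = "E_mat d L \<kappa> ord"
  have "complete_orthogonal_idempotents d (\<lambda>j. f_mat d ?E j j)"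
  proof (rule semi_orthogonal_triangular_complete)
    show "semi_orthogonal_idempotents d d ?E"
    proof
      show "?E j \<in> carrier_mat d d" if "j < d" for j
        using Z(1)[OF _ _ that] by (simp add: E_mat_def pow_carrier_mat)
      show "?E j * ?E j = ?E j" if "j < d" for j
        unfolding E_mat_def using that by (intro diag_delta_power_idempotent[of _ d j]) (auto simp: Z)
      show "?E j * ?E i = 0\<^sub>m d d" if "i < j" "j < d" for i j
        unfolding E_mat_def using that by (intro diag_delta_powers_orthogonal[of _ d _ i j]) (auto simp: Z)
    qed
    show "upper_triangular (?E j)" if "j < d" for j
      unfolding E_mat_def using pow_mat_diag[OF Z(1,2)[OF _ _ that]] by simp
    show "?E j $$ (a, a) = (if a = j then 1 else 0)" if "j < d" "a < d" for j a
      unfolding E_mat_def using pow_mat_diag[OF Z(1,2)[OF _ _ that(1)]] that by (simp add: Z)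
  qed
  then show "complete_orthogonal_idempotents d (e_mat d L \<kappa> ord)"
    by (simp add: e_mat_def[abs_def])
qed

end
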